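(* Let $\rho$ be a density matrix on a $d$-dimensional Hilbert space with orthonormal basis $\ket{0},\dots,\ket{d-1}$, let $V_{12},V_{23},\dots$ and $W_2,W_3,\dots$ be arbitrary $d\times d$ unitary matrices, put $W_1=\mathbf{1}$, and let $\rho_1,\rho_2,\dots$ be the density matrices after successive non-selective measurements (with the projectors $W_s\mathfrak{P}_fW_s^\dagger$ at step $s$), with unitary evolution $V_{s,s+1}$ between steps $s$ and $s+1$, as defined in the context. Let $\mathbf{x}^{(s)}$ be the corresponding measurement probability vectors. Then for every $s\ge 1$: (1) $\rho_{s}=\sum_f x^{(s)}_f\,W_{s}\mathfrak{P}_fW_{s}^\dagger$, i.e. $\rho_{s}$ is the diagonal matrix $\mathrm{diag}(x_0^{(s)},\dots,x_{d-1}^{(s)})$ in the basis $W_{s}\ket{f}$; (2) $\mathbf{x}^{(s+1)}=\mathbf{x}^{(s)}\mathfrak{D}_{s,s+1}$, where $$\mathfrak{D}_{s,s+1}(g,f)=\big|(W_s^\dagger V_{s,s+1}W_{s+1})(g,f)\big|^2,\qquad g,f=0,\dots,d-1,$$ and $\mathfrak{D}_{s,s+1}$ is a doubly stochastic matrix. (3) Consequently $\mathbf{x}^{(s+1)}=\mathbf{x}^{(k)}\mathfrak{D}_{k,s+1}$ for all $k<s+1$, where $\mathfrak{D}_{k,\ell}=\mathfrak{D}_{k,k+1}\mathfrak{D}_{k+1,k+2}\cdots\mathfrak{D}_{\ell-1,\ell}$.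
   Context: $\mathfrak{P}_f=|f\rangle\langle f|$ for $f=0,\dots,d-1$; matrix elements are taken in the basis $\ket{f}$, e.g. $A(g,f)=\langle g|A|f\rangle$. Here $\ket{f}$ is the basis vector $|f\rangle$. Probability vectors are rows. A $d\times d$ real matrix is doubly stochastic if its entries are non-negative and all row sums and column sums equal $1$. A non-selective measurement with orthogonal rank-one projectors $Q_0,\dots,Q_{d-1}$ summing to $\mathbf{1}$ maps a density matrix $\sigma$ to $\sum_f Q_f\sigma Q_f$; the associated probability vector has components $\mathrm{Tr}(\sigma Q_f)$. The process is $$\rho_1=\sum_f\mathfrak{P}_f\rho\,\mathfrak{P}_f,\qquad x^{(1)}_f=\mathrm{Tr}(\rho\,\mathfrak{P}_f),$$ and for $s\ge 1$ $$\widetilde\rho_{s+1}=V_{s,s+1}^\dagger\rho_sV_{s,s+1},\qquad \rho_{s+1}=\sum_f (W_{s+1}\mathfrak{P}_fW_{s+1}^\dagger)\,\widetilde\rho_{s+1}\,(W_{s+1}\mathfrak{P}_fW_{s+1}^\dagger),\qquad x^{(s+1)}_f=\mathrm{Tr}(\widetilde\rho_{s+1}W_{s+1}\mathfrak{P}_fW_{s+1}^\dagger).$$ *)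

theory Defs
  imports "HOL-Analysis.Analysis"
begin

text \<open>
  The \<open>d\<close>-dimensional Hilbert space is coordinatised by its orthonormal basis: it is
  \<open>complex ^ 'n\<close> with \<open>d = CARD('n)\<close>, and the type \<open>'n\<close> takes the role of the
  labels \<open>0, \<dots>, d - 1\<close>.
\<close>

definition ket :: "'n \<Rightarrow> complex ^ 'n" where
  "ket f = axis f 1"

definition braket :: "complex ^ 'n \<Rightarrow> complex ^ 'n \<Rightarrow> complex" where
  "braket u v = (\<Sum>i\<in>UNIV. cnj (u $ i) * v $ i)"

definition ketbra :: "complex ^ 'n \<Rightarrow> complex ^ 'n \<Rightarrow> complex ^ 'n ^ 'n" where
  "ketbra u v = (\<chi> i j. u $ i * cnj (v $ j))"

definition dagger :: "complex ^ 'n ^ 'm \<Rightarrow> complex ^ 'm ^ 'n" where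
  "dagger A = (\<chi> i j. cnj (A $ j $ i))"

definition unitary_matrix :: "complex ^ 'n ^ 'n \<Rightarrow> bool" where
  "unitary_matrix U \<longleftrightarrow> dagger U ** U = mat 1 \<and> U ** dagger U = mat 1"

definition density_matrix :: "complex ^ 'n ^ 'n \<Rightarrow> bool" where
  "density_matrix A \<longleftrightarrow>
     dagger A = A \<and> (\<forall>v. 0 \<le> Re (braket v (A *v v))) \<and> trace A = 1"

definition doubly_stochastic :: "real ^ 'n ^ 'n \<Rightarrow> bool" where
  "doubly_stochastic A \<longleftrightarrow>
     (\<forall>i j. 0 \<le> A $ i $ j) \<and>
     (\<forall>i. (\<Sum>j\<in>UNIV. A $ i $ j) = 1) \<and>
     (\<forall>j. (\<Sum>i\<in>UNIV. A $ i $ j) = 1)"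

definition matrix_in_basis ::
    "('n \<Rightarrow> complex ^ 'n) \<Rightarrow> complex ^ 'n ^ 'n \<Rightarrow> complex ^ 'n ^ 'n" where
  "matrix_in_basis b A = (\<chi> g f. braket (b g) (A *v b f))"

definition diagonal :: "real ^ 'n \<Rightarrow> complex ^ 'n ^ 'n" where
  "diagonal x = (\<chi> g f. if g = f then complex_of_real (x $ f) else 0)"

definition basis_proj :: "'n \<Rightarrow> complex ^ 'n ^ 'n" where
  "basis_proj f = ketbra (ket f) (ket f)"

definition rotated_proj :: "complex ^ 'n ^ 'n \<Rightarrow> 'n \<Rightarrow> complex ^ 'n ^ 'n" where
  "rotated_proj U f = U ** basis_proj f ** dagger U"

definition nonselective ::
    "('n \<Rightarrow> complex ^ 'n ^ 'n) \<Rightarrow> complex ^ 'n ^ 'n \<Rightarrow> complex ^ 'n ^ 'n" where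
  "nonselective Q \<sigma> = (\<Sum>f\<in>UNIV. Q f ** \<sigma> ** Q f)"

text \<open>
  Probability vectors are real. Taking the real part of the trace loses nothing, since the trace
  is real for Hermitian \<open>\<sigma>\<close> and \<open>Q f\<close>; see \<open>prob_one\<close> and \<open>prob_Suc\<close> below.
\<close>

definition meas_prob ::
    "('n \<Rightarrow> complex ^ 'n ^ 'n) \<Rightarrow> complex ^ 'n ^ 'n \<Rightarrow> real ^ 'n" where
  "meas_prob Q \<sigma> = (\<chi> f. Re (trace (\<sigma> ** Q f)))"

definition evolve :: "complex ^ 'n ^ 'n \<Rightarrow> complex ^ 'n ^ 'n \<Rightarrow> complex ^ 'n ^ 'n" where
  "evolve U \<sigma> = dagger U ** \<sigma> ** U"

text \<open>
  \<open>V s\<close> is the evolution between steps \<open>s\<close> and \<open>s + 1\<close>, and \<open>W s\<close> is the rotation of the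
  measurement basis at step \<open>s\<close>. Steps are numbered from 1; the values at 0 are mere conventions.
\<close>

fun post_state ::
    "complex ^ 'n ^ 'n \<Rightarrow> (nat \<Rightarrow> complex ^ 'n ^ 'n) \<Rightarrow> (nat \<Rightarrow> complex ^ 'n ^ 'n)
      \<Rightarrow> nat \<Rightarrow> complex ^ 'n ^ 'n" where
  "post_state \<rho> V W 0 = \<rho>"
| "post_state \<rho> V W (Suc 0) = nonselective basis_proj \<rho>"
| "post_state \<rho> V W (Suc (Suc s)) =
     nonselective (rotated_proj (W (Suc (Suc s))))
       (evolve (V (Suc s)) (post_state \<rho> V W (Suc s)))"

fun prob_vec ::
    "complex ^ 'n ^ 'n \<Rightarrow> (nat \<Rightarrow> complex ^ 'n ^ 'n) \<Rightarrow> (nat \<Rightarrow> complex ^ 'n ^ 'n)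
      \<Rightarrow> nat \<Rightarrow> real ^ 'n" where
  "prob_vec \<rho> V W 0 = 0"
| "prob_vec \<rho> V W (Suc 0) = meas_prob basis_proj \<rho>"
| "prob_vec \<rho> V W (Suc (Suc s)) =
     meas_prob (rotated_proj (W (Suc (Suc s))))
       (evolve (V (Suc s)) (post_state \<rho> V W (Suc s)))"

definition transition ::
    "(nat \<Rightarrow> complex ^ 'n ^ 'n) \<Rightarrow> (nat \<Rightarrow> complex ^ 'n ^ 'n) \<Rightarrow> nat \<Rightarrow> real ^ 'n ^ 'n" where
  "transition V W s = (\<chi> g f. (cmod ((dagger (W s) ** V s ** W (Suc s)) $ g $ f))\<^sup>2)"

definition transition_prod ::
    "(nat \<Rightarrow> complex ^ 'n ^ 'n) \<Rightarrow> (nat \<Rightarrow> complex ^ 'n ^ 'n) \<Rightarrow> nat \<Rightarrow> nat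
      \<Rightarrow> real ^ 'n ^ 'n" where
  "transition_prod V W k l = foldr (**) (map (transition V W) [k..<l]) (mat 1)"

lemma dagger_mult: "dagger (A ** B) = dagger B ** dagger A"
  by (simp add: dagger_def matrix_matrix_mult_def vec_eq_iff mult.commute)

lemma dagger_dagger [simp]: "dagger (dagger A) = A"
  by (simp add: dagger_def vec_eq_iff)

lemma dagger_sum: "dagger (\<Sum>f\<in>S. A f) = (\<Sum>f\<in>S. dagger (A f))"
  by (simp add: dagger_def vec_eq_iff)

lemma dagger_basis_proj: "dagger (basis_proj f) = basis_proj f"
  by (simp add: dagger_def basis_proj_def ketbra_def vec_eq_iff mult.commute)

lemma dagger_rotated_proj: "dagger (rotated_proj U f) = rotated_proj U f"
  by (simp add: rotated_proj_def dagger_mult dagger_basis_proj matrix_mul_assoc)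

lemma dagger_evolve: "dagger A = A \<Longrightarrow> dagger (evolve U A) = evolve U A"
  by (simp add: evolve_def dagger_mult matrix_mul_assoc)

lemma dagger_nonselective:
  assumes "dagger A = A" "\<And>f. dagger (Q f) = Q f"
  shows "dagger (nonselective Q A) = nonselective Q A"
  using assms by (simp add: nonselective_def dagger_sum dagger_mult matrix_mul_assoc)

lemma dagger_post_state:
  assumes "density_matrix \<rho>"
  shows "dagger (post_state \<rho> V W s) = post_state \<rho> V W s"
proof -
  have "dagger \<rho> = \<rho>"
    using assms by (simp add: density_matrix_def)
  then show ?thesis
    by (induction \<rho> V W s rule: post_state.induct)
      (simp_all add: dagger_nonselective dagger_evolve dagger_basis_proj dagger_rotated_proj)
qed

lemma trace_dagger: "trace (dagger A) = cnj (trace A)"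
  by (simp add: trace_def dagger_def)

lemma of_real_meas_prob:
  assumes "dagger \<sigma> = \<sigma>" "dagger (Q f) = Q f"
  shows "complex_of_real (meas_prob Q \<sigma> $ f) = trace (\<sigma> ** Q f)"
proof -
  have "cnj (trace (\<sigma> ** Q f)) = trace (Q f ** \<sigma>)"
    using assms by (simp add: trace_dagger [symmetric] dagger_mult)
  also have "\<dots> = trace (\<sigma> ** Q f)"
    by (rule trace_mul_sym)
  finally have "Im (trace (\<sigma> ** Q f)) = 0"
    by (metis complex_cnj_cancel_iff cnj.sel(2) add.inverse_neutral neg_equal_zero)
  then show ?thesis
    by (simp add: meas_prob_def complex_eq_iff)
qed

lemma prob_one:
  assumes "density_matrix \<rho>"
  shows "complex_of_real (prob_vec \<rho> V W 1 $ f) = trace (\<rho> ** basis_proj f)"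
  using assms
  by (simp add: of_real_meas_prob dagger_basis_proj density_matrix_def)

lemma prob_Suc:
  assumes "density_matrix \<rho>" "1 \<le> s"
  shows "complex_of_real (prob_vec \<rho> V W (Suc s) $ f) =
    trace (evolve (V s) (post_state \<rho> V W s) ** rotated_proj (W (Suc s)) f)"
  using assms
  by (cases s)
    (simp_all add: of_real_meas_prob dagger_rotated_proj dagger_evolve dagger_post_state)

end

theory Submission
  imports Defs
begin

text \<open>
  Measuring \<open>\<sigma>\<close> in the basis \<open>U|f\<rangle>\<close> leaves \<open>U diag(x) U\<^sup>\<dagger>\<close>, where \<open>x\<close> is the
  diagonal of \<open>U\<^sup>\<dagger> \<sigma> U\<close>. Evolving this by \<open>V\<close> and measuring in the basis \<open>U'|f\<rangle>\<close> gives the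
  diagonal of \<open>B\<^sup>\<dagger> diag(x) B\<close> with \<open>B = U\<^sup>\<dagger> V U'\<close>, which is linear in \<open>x\<close> with the
  coefficients \<open>|B(g,f)|\<^sup>2\<close>; these are doubly stochastic because \<open>B\<close> is unitary.
\<close>

lemma dagger_mat_1 [simp]: "dagger (mat 1) = mat 1"
  by (auto simp: dagger_def mat_def vec_eq_iff)

lemma unitary_matrix_mat_1: "unitary_matrix (mat 1)"
  by (simp add: unitary_matrix_def)

lemma unitary_matrix_dagger: "unitary_matrix U \<Longrightarrow> unitary_matrix (dagger U)"
  by (simp add: unitary_matrix_def)

lemma unitary_matrix_mult:
  assumes "unitary_matrix A" "unitary_matrix B"
  shows "unitary_matrix (A ** B)"
proof -
  have "dagger (A ** B) ** (A ** B) = dagger B ** (dagger A ** A) ** B"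
    and "(A ** B) ** dagger (A ** B) = A ** (B ** dagger B) ** dagger A"
    by (simp_all add: dagger_mult matrix_mul_assoc)
  then show ?thesis
    using assms by (simp add: unitary_matrix_def)
qed

text \<open>Column sums are the diagonal entries of \<open>dagger B ** B\<close>, row sums those of
  \<open>B ** dagger B\<close>; unitarity makes both products \<open>mat 1\<close>.\<close>

lemma doubly_stochastic_unitary:
  assumes "unitary_matrix B"
  shows "doubly_stochastic (\<chi> g f. (cmod (B $ g $ f))\<^sup>2)"
proof -
  have "complex_of_real (\<Sum>g\<in>UNIV. (cmod (B $ g $ f))\<^sup>2) = (dagger B ** B) $ f $ f" for f
    by (simp add: matrix_matrix_mult_def dagger_def complex_norm_square mult.commute
        del: of_real_power)
  then have "complex_of_real (\<Sum>g\<in>UNIV. (cmod (B $ g $ f))\<^sup>2) = 1" for f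
    using assms by (simp only: unitary_matrix_def) (simp add: mat_def)
  moreover have "complex_of_real (\<Sum>f\<in>UNIV. (cmod (B $ g $ f))\<^sup>2) = (B ** dagger B) $ g $ g" for g
    by (simp add: matrix_matrix_mult_def dagger_def complex_norm_square del: of_real_power)
  then have "complex_of_real (\<Sum>f\<in>UNIV. (cmod (B $ g $ f))\<^sup>2) = 1" for g
    using assms by (simp only: unitary_matrix_def) (simp add: mat_def)
  ultimately show ?thesis
    by (simp only: of_real_eq_1_iff) (simp add: doubly_stochastic_def)
qed

lemma basis_proj_nth:
  "basis_proj f $ i $ j = (if i = f \<and> j = f then 1 else 0)"
  by (auto simp: basis_proj_def ketbra_def ket_def axis_def)

text \<open>Brings the first measurement under the lemmas on rotated projectors, in line with
  \<open>W 1 = mat 1\<close>.\<close>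

lemma basis_proj_eq_rotated_proj: "basis_proj = rotated_proj (mat 1)"
  by (simp add: rotated_proj_def fun_eq_iff)

lemma matrix_mult_nth: "(A ** B) $ i $ j = (\<Sum>k\<in>UNIV. A $ i $ k * B $ k $ j)"
  by (simp add: matrix_matrix_mult_def)

lemma dagger_nth: "dagger A $ i $ j = cnj (A $ j $ i)"
  by (simp add: dagger_def)

lemma mult_dagger_nth: "(A ** dagger U) $ i $ j = (\<Sum>k\<in>UNIV. A $ i $ k * cnj (U $ j $ k))"
  by (simp add: matrix_mult_nth dagger_nth)

lemma rotated_proj_nth: "rotated_proj U f $ i $ j = U $ i $ f * cnj (U $ j $ f)"
proof -
  have "(U ** basis_proj f) $ i $ k = (if k = f then U $ i $ f else 0)" for k
    by (auto simp: matrix_matrix_mult_def basis_proj_nth if_distrib cong: if_cong)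
  then show ?thesis
    by (simp add: rotated_proj_def mult_dagger_nth
        if_distrib [of "\<lambda>x. x * _"] cong: if_cong)
qed

lemma conjugate_nth:
  "(dagger U ** \<sigma> ** U) $ f $ f' = (\<Sum>j\<in>UNIV. \<Sum>i\<in>UNIV. cnj (U $ i $ f) * \<sigma> $ i $ j * U $ j $ f')"
  by (simp add: matrix_matrix_mult_def dagger_def sum_distrib_right)

lemma trace_mult_rotated_proj:
  "trace (\<sigma> ** rotated_proj U f) = (dagger U ** \<sigma> ** U) $ f $ f"
  unfolding conjugate_nth
  \<comment> \<open>The swap puts the row index of \<open>\<sigma>\<close> outermost, as in the
    trace.\<close>
  by (subst sum.swap) (simp add: trace_def matrix_matrix_mult_def rotated_proj_nth mult_ac)

text \<open>With u the \<open>f\<close>-th column of \<open>U\<close>,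
  \<open>rotated_proj U f\<close> is |u><u|, and |u><u|\<sigma>|u><u| = <u|\<sigma>|u> |u><u|. The
  scalar is the same diagonal entry as in \<open>trace_mult_rotated_proj\<close>.\<close>

lemma rotated_proj_sandwich_nth:
  "(rotated_proj U f ** \<sigma> ** rotated_proj U f) $ i $ j
    = (dagger U ** \<sigma> ** U) $ f $ f * rotated_proj U f $ i $ j"
  unfolding conjugate_nth
  by (simp add: matrix_matrix_mult_def rotated_proj_nth sum_distrib_right sum_distrib_left mult_ac)

text \<open>Hermiticity makes the scalar of each sandwich real, so it agrees with
  \<open>meas_prob\<close>, which keeps only the real part of the trace.\<close>

lemma nonselective_rotated_proj:
  assumes "dagger \<sigma> = \<sigma>"
  shows "nonselective (rotated_proj U) \<sigma>
    = (\<Sum>f\<in>UNIV. meas_prob (rotated_proj U) \<sigma> $ f *\<^sub>R rotated_proj U f)"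
proof -
  have "rotated_proj U f ** \<sigma> ** rotated_proj U f
      = meas_prob (rotated_proj U) \<sigma> $ f *\<^sub>R rotated_proj U f" for f
    using of_real_meas_prob [of \<sigma> "rotated_proj U" f, OF assms dagger_rotated_proj]
    by (simp add: vec_eq_iff rotated_proj_sandwich_nth trace_mult_rotated_proj
        scaleR_conv_of_real [where 'a = complex])
  then show ?thesis
    by (simp add: nonselective_def)
qed

lemma mult_diagonal_nth: "(A ** diagonal x) $ i $ f = A $ i $ f * complex_of_real (x $ f)"
  by (simp add: matrix_matrix_mult_def diagonal_def if_distrib [of "\<lambda>y. A $ i $ _ * y"] cong: if_cong)

text \<open>Turns the sum over outcomes into a matrix product, on which evolution and change of
  basis act by associativity.\<close>

lemma sum_rotated_proj:
  "(\<Sum>f\<in>UNIV. x $ f *\<^sub>R rotated_proj U f) = U ** diagonal x ** dagger U"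
  by (simp add: vec_eq_iff rotated_proj_nth mult_dagger_nth mult_diagonal_nth
      scaleR_conv_of_real [where 'a = complex] mult_ac)

lemma matrix_in_basis_columns:
  "matrix_in_basis (\<lambda>f. U *v ket f) A = dagger U ** A ** U"
proof -
  have "U *v ket f = (\<chi> i. U $ i $ f)" for f
    by (simp add: ket_def matrix_vector_mult_def axis_def vec_eq_iff
        if_distrib [of "\<lambda>x. _ * x"] cong: if_cong)
  then show ?thesis
    unfolding vec_eq_iff conjugate_nth
    by (subst sum.swap)
      (simp add: matrix_in_basis_def braket_def matrix_vector_mult_def sum_distrib_left mult_ac)
qed

lemma meas_prob_evolve:
  "meas_prob (rotated_proj U') (evolve V (U ** diagonal x ** dagger U))
    = x v* (\<chi> g f. (cmod ((dagger U ** V ** U') $ g $ f))\<^sup>2)"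
proof -
  define B where "B = dagger U ** V ** U'"
  have "dagger U' ** evolve V (U ** diagonal x ** dagger U) ** U' = dagger B ** diagonal x ** B"
    by (simp add: B_def evolve_def dagger_mult matrix_mul_assoc)
  \<comment> \<open>The entry is real because \<open>B $ g $ f\<close> meets its own conjugate; the
    real part in \<open>meas_prob\<close> then loses nothing.\<close>
  moreover have "(dagger B ** diagonal x ** B) $ f $ f
      = complex_of_real (\<Sum>g\<in>UNIV. x $ g * (cmod (B $ g $ f))\<^sup>2)" for f
    by (simp add: matrix_mult_nth [of "dagger B ** diagonal x" B] mult_diagonal_nth dagger_nth
        complex_norm_square mult_ac del: of_real_power)
  ultimately show ?thesis
    by (simp add: meas_prob_def trace_mult_rotated_proj vector_matrix_mult_def vec_eq_iff
        flip: B_def)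
qed

lemma transition_prod_Suc:
  assumes "k \<le> l"
  shows "transition_prod V W k (Suc l) = transition_prod V W k l ** transition V W l"
proof -
  \<comment> \<open>In \<open>[k..<Suc l]\<close> the new factor comes last, so \<open>foldr\<close>
    receives it as its seed; associativity moves the seed out to the right.\<close>
  have "foldr (**) As B = foldr (**) As (mat 1) ** B"
    for As :: "(real ^ 'n ^ 'n) list" and B :: "real ^ 'n ^ 'n"
    by (induction As) (simp_all add: matrix_mul_assoc [symmetric])
  from this [of _ "transition V W l"] show ?thesis
    using assms by (simp add: transition_prod_def)
qed

text \<open>A case distinction replaces induction: each measurement by itself produces the diagonal
  form from any Hermitian state. Only the first one acts on \<open>\<rho>\<close> without a
  preceding evolution.\<close>

lemma post_state_eq_sum:
  assumes "density_matrix \<rho>" "W 1 = mat 1" "1 \<le> s"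
  shows "post_state \<rho> V W s = (\<Sum>f\<in>UNIV. prob_vec \<rho> V W s $ f *\<^sub>R rotated_proj (W s) f)"
proof (cases "s = 1")
  case True
  then show ?thesis
    using assms nonselective_rotated_proj [of \<rho> "mat 1"]
    by (simp add: basis_proj_eq_rotated_proj density_matrix_def)
next
  case False
  then obtain t where "s = Suc (Suc t)"
    using assms(3) by (metis One_nat_def not0_implies_Suc not_one_le_zero)
  then show ?thesis
    by (simp add: nonselective_rotated_proj dagger_evolve dagger_post_state assms(1))
qed

text \<open>The state after step \<open>s\<close> is determined by
  \<open>prob_vec \<rho> V W s\<close> and \<open>W s\<close>, so the next probabilities depend on
  the past only through that vector.\<close>

lemma prob_vec_Suc:
  assumes "density_matrix \<rho>" "W 1 = mat 1" "1 \<le> s"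
  shows "prob_vec \<rho> V W (Suc s) = prob_vec \<rho> V W s v* transition V W s"
proof -
  have "prob_vec \<rho> V W (Suc s)
      = meas_prob (rotated_proj (W (Suc s))) (evolve (V s) (post_state \<rho> V W s))"
    using assms(3) by (cases s) simp_all
  then show ?thesis
    by (simp add: post_state_eq_sum [where W = W, OF assms] sum_rotated_proj meas_prob_evolve
        transition_def)
qed

lemma prob_vec_transition_prod:
  assumes "density_matrix \<rho>" "W 1 = mat 1" "1 \<le> k" "k \<le> l"
  shows "prob_vec \<rho> V W l = prob_vec \<rho> V W k v* transition_prod V W k l"
  using assms(4)
proof (induction l rule: dec_induct)
  case base
  then show ?case
    by (simp add: transition_prod_def)
next
  case (step l)
  then show ?case
    using assms by (simp add: prob_vec_Suc transition_prod_Suc vector_matrix_mul_assoc)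
qed

theorem mainTheorem3:
  fixes \<rho> :: "complex ^ 'n ^ 'n"
    and V W :: "nat \<Rightarrow> complex ^ 'n ^ 'n"
    and s :: nat
  assumes "density_matrix \<rho>"
    and "\<And>t. 1 \<le> t \<Longrightarrow> unitary_matrix (V t)"
    and "\<And>t. 2 \<le> t \<Longrightarrow> unitary_matrix (W t)"
    and "W 1 = mat 1"
    and "1 \<le> s"
  shows "post_state \<rho> V W s = (\<Sum>f\<in>UNIV. prob_vec \<rho> V W s $ f *\<^sub>R rotated_proj (W s) f)
    \<and> matrix_in_basis (\<lambda>f. W s *v ket f) (post_state \<rho> V W s) = diagonal (prob_vec \<rho> V W s)
    \<and> prob_vec \<rho> V W (s + 1) = prob_vec \<rho> V W s v* transition V W s
    \<and> doubly_stochastic (transition V W s)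
    \<and> (\<forall>k. 1 \<le> k \<and> k < s + 1 \<longrightarrow>
         prob_vec \<rho> V W (s + 1) = prob_vec \<rho> V W k v* transition_prod V W k (s + 1))"
proof -
  have W: "unitary_matrix (W t)" if "1 \<le> t" for t
    using assms(3,4) that unitary_matrix_mat_1 by (cases "t = 1") auto
  note post = post_state_eq_sum [where V = V and W = W, OF assms(1,4,5)]
  define D where "D = diagonal (prob_vec \<rho> V W s)"
  \<comment> \<open>Regrouped so that unitarity of \<open>W s\<close> cancels the factors on both
    sides of \<open>D\<close>.\<close>
  have "dagger (W s) ** (W s ** D ** dagger (W s)) ** W s
      = (dagger (W s) ** W s) ** D ** (dagger (W s) ** W s)"
    by (simp add: matrix_mul_assoc)
  then have "matrix_in_basis (\<lambda>f. W s *v ket f) (post_state \<rho> V W s) = D"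
    using W [OF assms(5)]
    by (simp add: post sum_rotated_proj matrix_in_basis_columns unitary_matrix_def flip: D_def)
  moreover have "doubly_stochastic (transition V W s)"
    unfolding transition_def using assms(2,5) W
    by (intro doubly_stochastic_unitary unitary_matrix_mult unitary_matrix_dagger) simp_all
  moreover have "prob_vec \<rho> V W (s + 1) = prob_vec \<rho> V W k v* transition_prod V W k (s + 1)"
    if "1 \<le> k \<and> k < s + 1" for k
    using that prob_vec_transition_prod [where W = W, OF assms(1,4)] by simp
  ultimately show ?thesis
    using post prob_vec_Suc [where W = W, OF assms(1,4,5)] by (simp add: D_def)
qed

end
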